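(* Let $n,m,p$ be positive integers, none of which is divisible by $10$. Then: 1. $\widetilde{\widetilde{n}}=n$. 2. $\widetilde{n}\diamond\widetilde{m}=\widetilde{m\diamond n}$. 3. $(m\diamond n)\diamond p=m\diamond(n\diamond p)$. 4. If $n$ is palindrome and $C(n)$ is even, then $11$ is a divisor of $n$. 5. $11\mid n\diamond\widetilde{n}$.
   Context: For a positive integer $n$ with decimal expansion $n=\sum_{j=0}^{r}a_{r-j}10^{r-j}$ (digits $a_i\in\{0,\dots,9\}$, $a_r\neq 0$), $C(n)=r+1$ denotes its number of decimal digits, and its Reversing is $\widetilde{n}=\sum_{j=0}^{r}a_j10^{r-j}$. The number $n$ is palindrome if $n=\widetilde{n}$. The Pasting of $n$ and $m$ is $n\diamond m=10^{C(m)}n+m$. *)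

theory Defs
  imports Main
begin

text \<open>Only the values \<open>a i\<close> with \<open>i \<le> r\<close> matter: \<open>a i\<close> is the coefficient of \<open>10 ^ i\<close>.\<close>

definition decimal_expansion :: "nat \<Rightarrow> nat \<Rightarrow> (nat \<Rightarrow> nat) \<Rightarrow> bool" where
  "decimal_expansion n r a \<longleftrightarrow>
     (\<forall>i\<le>r. a i \<le> 9) \<and> a r \<noteq> 0 \<and> n = (\<Sum>j=0..r. a (r - j) * 10 ^ (r - j))"

text \<open>
  The two descriptions below denote a unique number for every positive argument, see
  \<open>decimal_expansion_exists\<close>, \<open>num_digits_eq\<close> and \<open>reversing_eq\<close>. Nothing is claimed about the argument \<open>0\<close>.
\<close>

definition num_digits :: "nat \<Rightarrow> nat" where
  "num_digits n = (THE k. \<exists>r a. decimal_expansion n r a \<and> k = r + 1)"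

definition reversing :: "nat \<Rightarrow> nat" where
  "reversing n = (THE m. \<exists>r a. decimal_expansion n r a \<and> m = (\<Sum>j=0..r. a j * 10 ^ (r - j)))"

definition palindrome :: "nat \<Rightarrow> bool" where
  "palindrome n \<longleftrightarrow> n = reversing n"

definition pasting :: "nat \<Rightarrow> nat \<Rightarrow> nat"  (infixl \<open>\<diamondop>\<close> 70) where
  "n \<diamondop> m = 10 ^ num_digits m * n + m"

lemma decimal_expansion_sum:
  fixes a :: "nat \<Rightarrow> nat"
  shows "(\<Sum>j=0..r. a (r - j) * 10 ^ (r - j)) = (\<Sum>i\<le>r. a i * 10 ^ i)"
  using sum.atLeastAtMost_rev[of "\<lambda>i. a i * 10 ^ i" 0 r] by (simp add: atLeast0AtMost)

lemma decimal_expansion_iff: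
  "decimal_expansion n r a \<longleftrightarrow> (\<forall>i\<le>r. a i \<le> 9) \<and> a r \<noteq> 0 \<and> n = (\<Sum>i\<le>r. a i * 10 ^ i)"
  by (simp only: decimal_expansion_def decimal_expansion_sum)

lemma digit_sum_less:
  fixes a :: "nat \<Rightarrow> nat"
  assumes "\<forall>i\<le>r. a i \<le> 9"
  shows "(\<Sum>i\<le>r. a i * 10 ^ i) < 10 ^ (r + 1)"
  using assms
proof (induction r)
  case (Suc r)
  have "(\<Sum>i\<le>r. a i * 10 ^ i) < 10 ^ (r + 1)" using Suc by simp
  moreover have "a (Suc r) * 10 ^ Suc r \<le> 9 * 10 ^ Suc r"
    using Suc.prems by (intro mult_right_mono) auto
  ultimately have "(\<Sum>i\<le>r. a i * 10 ^ i) + a (Suc r) * 10 ^ Suc r < 10 ^ Suc r + 9 * 10 ^ Suc r"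
    by (metis Suc_eq_plus1 add_less_le_mono)
  then show ?case by simp
qed auto

lemma digit_sum_inj:
  fixes a b :: "nat \<Rightarrow> nat"
  assumes "\<forall>i\<le>r. a i \<le> 9" "\<forall>i\<le>r. b i \<le> 9"
    and "(\<Sum>i\<le>r. a i * 10 ^ i) = (\<Sum>i\<le>r. b i * 10 ^ i)" and "i \<le> r"
  shows "a i = b i"
  using assms
proof (induction r arbitrary: i)
  case (Suc r)
  let ?A = "\<Sum>i\<le>r. a i * 10 ^ i" and ?B = "\<Sum>i\<le>r. b i * 10 ^ i" and ?p = "10 ^ Suc r :: nat"
  have A: "?A < ?p" and B: "?B < ?p"
    using digit_sum_less[of r a] digit_sum_less[of r b] Suc.prems by simp_all
  have eq: "?A + a (Suc r) * ?p = ?B + b (Suc r) * ?p" using Suc.prems(3) by simp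
  have "a (Suc r) = (?A + a (Suc r) * ?p) div ?p" using A by (subst div_mult_self1) auto
  also have "\<dots> = b (Suc r)" unfolding eq using B by (subst div_mult_self1) auto
  finally have top: "a (Suc r) = b (Suc r)" .
  with eq have "?A = ?B" by simp
  then have "a i = b i" if "i \<le> r" for i
    using Suc.prems(1,2) that by (intro Suc.IH) auto
  with top Suc.prems(4) show ?case by (metis le_Suc_eq)
qed auto

lemma decimal_expansion_unique:
  assumes "decimal_expansion n r a" "decimal_expansion n s b"
  shows "r = s \<and> (\<forall>i\<le>r. a i = b i)"
proof -
  have bounds: "10 ^ r \<le> n \<and> n < 10 ^ (r + 1)" if "decimal_expansion n r a" for r a
  proof -
    have n: "n = (\<Sum>i\<le>r. a i * 10 ^ i)" and "a r \<noteq> 0" "\<forall>i\<le>r. a i \<le> 9"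
      using that by (simp_all add: decimal_expansion_iff)
    have "10 ^ r \<le> a r * 10 ^ r" using \<open>a r \<noteq> 0\<close> by simp
    also have "\<dots> \<le> n" unfolding n by (rule member_le_sum) auto
    finally show ?thesis using digit_sum_less \<open>\<forall>i\<le>r. a i \<le> 9\<close> n by simp
  qed
  have "(10::nat) ^ r < 10 ^ (s + 1)" "(10::nat) ^ s < 10 ^ (r + 1)"
    using bounds[OF assms(1)] bounds[OF assms(2)] by linarith+
  then have "r < s + 1" "s < r + 1" by (simp_all only: power_strict_increasing_iff one_less_numeral_iff semiring_norm)
  then have "r = s" by simp
  with assms digit_sum_inj[of r a b] show ?thesis
    by (simp add: decimal_expansion_iff)
qed

lemma decimal_expansion_exists:
  assumes "n > 0"
  shows "\<exists>r a. decimal_expansion n r a"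
  using assms
proof (induction n rule: less_induct)
  case (less n)
  show ?case
  proof (cases "n < 10")
    case True
    with less.prems have "decimal_expansion n 0 (\<lambda>_. n)" by (simp add: decimal_expansion_def)
    then show ?thesis by blast
  next
    case False
    then obtain r a where ra: "decimal_expansion (n div 10) r a"
      using less.IH[of "n div 10"] by fastforce
    define b where "b i = (case i of 0 \<Rightarrow> n mod 10 | Suc j \<Rightarrow> a j)" for i
    have "(\<Sum>i\<le>Suc r. b i * 10 ^ i) = n mod 10 + 10 * (n div 10)"
      unfolding sum.atMost_Suc_shift using ra
      by (simp add: b_def decimal_expansion_iff sum_distrib_left mult_ac)
    moreover have "b i \<le> 9" if "i \<le> Suc r" for i
      using ra that by (cases i) (auto simp: b_def decimal_expansion_def)
    moreover have "b (Suc r) \<noteq> 0" using ra by (simp add: b_def decimal_expansion_def)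
    ultimately have "decimal_expansion n (Suc r) b"
      unfolding decimal_expansion_iff by (simp del: sum.atMost_Suc)
    then show ?thesis by blast
  qed
qed

lemma num_digits_eq:
  assumes "decimal_expansion n r a"
  shows "num_digits n = r + 1"
  unfolding num_digits_def
proof (rule the_equality)
  fix k assume "\<exists>s b. decimal_expansion n s b \<and> k = s + 1"
  then show "k = r + 1" using decimal_expansion_unique[OF assms] by blast
qed (use assms in blast)

lemma reversing_eq:
  assumes "decimal_expansion n r a"
  shows "reversing n = (\<Sum>j=0..r. a j * 10 ^ (r - j))"
  unfolding reversing_def
proof (rule the_equality)
  fix m assume "\<exists>s b. decimal_expansion n s b \<and> m = (\<Sum>j=0..s. b j * 10 ^ (s - j))"
  then obtain s b where sb: "decimal_expansion n s b" "m = (\<Sum>j=0..s. b j * 10 ^ (s - j))"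
    by blast
  from decimal_expansion_unique[OF assms sb(1)] have "s = r" "\<forall>i\<le>r. a i = b i" by auto
  with sb(2) show "m = (\<Sum>j=0..r. a j * 10 ^ (r - j))" by (auto intro!: sum.cong)
qed (use assms in blast)

end

theory Submission
  imports Defs
begin

text \<open>
  The digit sequence of a reversing is the digit sequence read backwards, and that of a pasting
  is a concatenation, so the first three claims are identities between digit sequences. For the
  last claim, with \<open>n = (\<Sum>i\<le>r. a i * 10 ^ i)\<close>, the pasting of \<open>n\<close> and its reversing is
  \<open>(\<Sum>i\<le>r. a i * 10 ^ (r - i) * (10 ^ (2 * i + 1) + 1))\<close>, and \<open>11\<close> divides \<open>10\<^sup>k + 1\<close> for odd \<open>k\<close>.
  If \<open>n\<close> is a palindrome with an even number \<open>k\<close> of digits, that pasting is \<open>(10\<^sup>k + 1) * n\<close>,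
  which is congruent to \<open>2 * n\<close> modulo \<open>11\<close>.
\<close>

lemma reversing_eq_rev_digits:
  assumes "decimal_expansion n r a"
  shows "reversing n = (\<Sum>i\<le>r. a (r - i) * 10 ^ i)"
  unfolding reversing_eq[OF assms] atLeast0AtMost
  by (rule sum.reindex_bij_witness[of _ "\<lambda>i. r - i" "\<lambda>i. r - i"]) auto

text \<open>Since 10 does not divide \<open>n\<close>, its last digit \<open>a 0\<close> is nonzero,
  so it can serve as the leading digit after reversal and no digit is lost.\<close>

lemma decimal_expansion_reversing:
  assumes "decimal_expansion n r a" and "\<not> 10 dvd n"
  shows "decimal_expansion (reversing n) r (\<lambda>i. a (r - i))"
proof -
  have "a 0 \<noteq> 0"
  proof
    assume "a 0 = 0"
    then have "10 dvd a i * 10 ^ i" for i by (cases i) auto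
    then have "10 dvd n" using assms(1) by (auto simp: decimal_expansion_iff intro: dvd_sum)
    with assms(2) show False ..
  qed
  then show ?thesis
    using assms(1) reversing_eq_rev_digits[OF assms(1)] by (simp add: decimal_expansion_iff)
qed

lemma reversing_reversing:
  assumes "n > 0" and "\<not> 10 dvd n"
  shows "reversing (reversing n) = n"
proof -
  obtain r a where a: "decimal_expansion n r a"
    using decimal_expansion_exists[OF assms(1)] by blast
  then show ?thesis
    using reversing_eq_rev_digits[OF decimal_expansion_reversing[OF a assms(2)]]
    by (simp add: decimal_expansion_iff)
qed

lemma sum_lessThan_split_at:
  fixes f :: "nat \<Rightarrow> 'a::comm_monoid_add"
  shows "(\<Sum>i<k + l. f i) = (\<Sum>i<k. f i) + (\<Sum>j<l. f (k + j))"
  by (induction l) (simp_all add: add.assoc)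

text \<open>The factor \<open>10 ^ (r + 1)\<close> moves the digits of \<open>m\<close> just above
  the \<open>r + 1\<close> digits of \<open>n\<close>, so no carry occurs.\<close>

lemma decimal_expansion_pasting:
  assumes m: "decimal_expansion m s b" and n: "decimal_expansion n r a"
  shows "decimal_expansion (m \<diamondop> n) (s + r + 1) (\<lambda>i. if i \<le> r then a i else b (i - (r + 1)))"
proof -
  let ?c = "\<lambda>i. if i \<le> r then a i else b (i - (r + 1))"
  have "(\<Sum>i\<le>s + r + 1. ?c i * 10 ^ i) = (\<Sum>i<r + 1 + (s + 1). ?c i * 10 ^ i)"
    by (rule sum.cong) auto
  also have "\<dots> = (\<Sum>i<r + 1. ?c i * 10 ^ i) + (\<Sum>j<s + 1. ?c (r + 1 + j) * 10 ^ (r + 1 + j))"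
    by (rule sum_lessThan_split_at)
  also have "(\<Sum>i<r + 1. ?c i * 10 ^ i) = n"
    using n by (simp add: decimal_expansion_iff lessThan_Suc_atMost del: sum.lessThan_Suc)
  also have "(\<Sum>j<s + 1. ?c (r + 1 + j) * 10 ^ (r + 1 + j)) = 10 ^ (r + 1) * m"
    using m
    by (simp add: decimal_expansion_iff lessThan_Suc_atMost sum_distrib_left power_add mult_ac
        del: sum.lessThan_Suc)
  finally have "m \<diamondop> n = (\<Sum>i\<le>s + r + 1. ?c i * 10 ^ i)"
    by (simp add: pasting_def num_digits_eq[OF n])
  moreover have "?c i \<le> 9" if "i \<le> s + r + 1" for i
    using m n that by (auto simp: decimal_expansion_iff)
  moreover have "?c (s + r + 1) \<noteq> 0" using m by (simp add: decimal_expansion_iff)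
  ultimately show ?thesis unfolding decimal_expansion_iff by blast
qed

lemma num_digits_pasting:
  assumes "m > 0" and "n > 0"
  shows "num_digits (m \<diamondop> n) = num_digits m + num_digits n"
proof -
  obtain r a s b where "decimal_expansion n r a" "decimal_expansion m s b"
    using decimal_expansion_exists assms by metis
  then show ?thesis
    using num_digits_eq[OF decimal_expansion_pasting] by (simp add: num_digits_eq)
qed

text \<open>As digit counts add, both sides expand to the same three summands, with \<open>m\<close>
  shifted by the combined length of \<open>n\<close> and \<open>p\<close>.\<close>

lemma pasting_assoc:
  assumes "n > 0" and "p > 0"
  shows "(m \<diamondop> n) \<diamondop> p = m \<diamondop> (n \<diamondop> p)"
  using num_digits_pasting[OF assms] by (simp add: pasting_def power_add algebra_simps)

lemma reversing_pasting:
  assumes "n > 0" and "m > 0" and "\<not> 10 dvd n" and "\<not> 10 dvd m"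
  shows "reversing (m \<diamondop> n) = reversing n \<diamondop> reversing m"
proof -
  obtain r a s b where a: "decimal_expansion n r a" and b: "decimal_expansion m s b"
    using decimal_expansion_exists assms by metis
  have "reversing n \<diamondop> reversing m
    = (\<Sum>i\<le>r + s + 1. (if i \<le> s then b (s - i) else a (r - (i - (s + 1)))) * 10 ^ i)"
    using decimal_expansion_pasting[OF decimal_expansion_reversing[OF a assms(3)]
        decimal_expansion_reversing[OF b assms(4)]]
    unfolding decimal_expansion_iff by blast
  also have "\<dots> = reversing (m \<diamondop> n)"
    unfolding reversing_eq_rev_digits[OF decimal_expansion_pasting[OF b a]]
    \<comment> \<open>For \<open>i \<le> r + s + 1\<close>, the reflected index
      \<open>s + r + 1 - i\<close> falls among the digits of \<open>n\<close> exactly when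
      \<open>i > s\<close>.\<close>
    by (rule sum.cong) (auto simp: add.commute Suc_diff_le)
  finally show ?thesis ..
qed

lemma eleven_dvd_odd_power_add_one: "11 dvd (10 ^ (2 * k + 1) + 1 :: nat)"
proof (induction k)
  case (Suc k)
  \<comment> \<open>Raising the exponent by 2 adds \<open>99 = 11 * 9\<close> times the old
    power.\<close>
  have "(10::nat) ^ (2 * Suc k + 1) + 1 = (10 ^ (2 * k + 1) + 1) + 11 * (9 * 10 ^ (2 * k + 1))"
    by simp
  with Suc show ?case by (metis dvd_add dvd_triv_left)
qed simp

lemma eleven_dvd_pasting_reversing:
  assumes "n > 0" and "\<not> 10 dvd n"
  shows "11 dvd n \<diamondop> reversing n"
proof -
  obtain r a where a: "decimal_expansion n r a"
    using decimal_expansion_exists[OF assms(1)] by blast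
  have "n \<diamondop> reversing n = (\<Sum>i\<le>r. 10 ^ (r + 1) * (a i * 10 ^ i) + a i * 10 ^ (r - i))"
    using a reversing_eq[OF a] num_digits_eq[OF decimal_expansion_reversing[OF a assms(2)]]
    by (simp add: pasting_def decimal_expansion_iff sum.distrib sum_distrib_left atLeast0AtMost)
  also have "\<dots> = (\<Sum>i\<le>r. a i * 10 ^ (r - i) * (10 ^ (2 * i + 1) + 1))"
  proof (rule sum.cong)
    fix i assume "i \<in> {..r}"
    \<comment> \<open>The digit \<open>a i\<close> occurs at position \<open>r + 1 + i\<close> in
      the copy of \<open>n\<close> and at \<open>r - i\<close> in its reversing; the gap is
      odd.\<close>
    then have "r + 1 + i = (r - i) + (2 * i + 1)" by simp
    then have "(10::nat) ^ (r + 1) * 10 ^ i = 10 ^ (r - i) * 10 ^ (2 * i + 1)"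
      by (metis power_add)
    then show "10 ^ (r + 1) * (a i * 10 ^ i) + a i * 10 ^ (r - i)
        = a i * 10 ^ (r - i) * (10 ^ (2 * i + 1) + 1)"
      by (simp only: mult.left_commute[of "10 ^ (r + 1)"] mult.assoc distrib_left mult_1_right)
  qed simp
  finally show ?thesis
    by (simp only:) (intro dvd_sum dvd_mult eleven_dvd_odd_power_add_one)
qed

lemma eleven_dvd_even_palindrome:
  assumes "n > 0" and "\<not> 10 dvd n" and "palindrome n" and "even (num_digits n)"
  shows "11 dvd n"
proof -
  obtain k where k: "num_digits n = 2 * k" using assms(4) by blast
  \<comment> \<open>Even powers of 10 are powers of 100, and
    \<open>100 = 9 * 11 + 1\<close>.\<close>
  have "(10::nat) ^ (2 * k) mod 11 = (100 mod 11) ^ k mod 11"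
    unfolding power_mult power_mod by simp
  then have "(10::nat) ^ (2 * k) mod 11 = 1" by simp
  then have "(10 ^ (2 * k) * n + n) mod 11 = (2 * n) mod 11"
    by (metis mod_add_left_eq mod_mult_left_eq mult_1 mult_2)
  moreover have "11 dvd 10 ^ (2 * k) * n + n"
    using eleven_dvd_pasting_reversing[OF assms(1,2)] assms(3) k
    by (simp add: palindrome_def pasting_def)
  ultimately have "11 dvd 2 * n" by (simp add: dvd_eq_mod_eq_0)
  \<comment> \<open>The factor 2 cancels because it is coprime to 11.\<close>
  then show ?thesis by presburger
qed

theorem proposition2p13:
  fixes n m p :: nat
  assumes "n > 0" and "m > 0" and "p > 0"
    and "\<not> 10 dvd n" and "\<not> 10 dvd m" and "\<not> 10 dvd p"
  shows "reversing (reversing n) = n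
    \<and> reversing n \<diamondop> reversing m = reversing (m \<diamondop> n)
    \<and> (m \<diamondop> n) \<diamondop> p = m \<diamondop> (n \<diamondop> p)
    \<and> (palindrome n \<and> even (num_digits n) \<longrightarrow> 11 dvd n)
    \<and> 11 dvd n \<diamondop> reversing n"
  using assms reversing_reversing reversing_pasting pasting_assoc eleven_dvd_even_palindrome
    eleven_dvd_pasting_reversing by simp

end
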